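(* Polyak's heavy ball method is equivalent to the generalized momentum dynamics $$\dot{\mathbf{x}}_t=\frac{\dot\alpha_t(\nabla\psi^*(\mathbf{z}_t)-\mathbf{x}_t)}{\alpha_t},\qquad \dot{\mathbf{z}}_t=-h(\alpha_t)\frac{\dot\alpha_t}{\alpha_t}\nabla f(\mathbf{x}_t),$$ when $\mathcal{X}=\mathbb{R}^n$, $\|\cdot\|=\|\cdot\|_2$, $\psi^*(\mathbf{z})=\frac{1}{2\mu}\|\mathbf{z}\|_2^2$, $h(\tau)=\tau^0=1$, and $\frac{\dot\alpha_t}{\alpha_t}=\eta>0$.
   Context: $f:\mathcal{X}\to\mathbb{R}$ is the continuously differentiable function being minimized over the closed convex set $\mathcal{X}$, and $\mu>0$. Polyak's heavy ball method in continuous time is the second-order ODE $\ddot{\mathbf{x}}_t=\alpha_1\dot{\mathbf{x}}_t+\alpha_2\nabla f(\mathbf{x}_t)$, where $\alpha_1,\alpha_2$ are constants. In the generalized momentum dynamics, $\alpha_t>0$ is a strictly increasing differentiable function of time $t$, $h$ is a positive function, and $\psi^*$ is the convex conjugate of a strongly convex function $\psi:\mathcal{X}\to\mathbb{R}$, that is, $\psi^*(\mathbf{z})=\sup_{\mathbf{x}\in\mathcal{X}}\{\langle\mathbf{z},\mathbf{x}\rangle-\psi(\mathbf{x})\}$. *)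

theory Defs
  imports "HOL-Analysis.Analysis"
begin

definition gradient :: "('a::real_inner \<Rightarrow> real) \<Rightarrow> 'a \<Rightarrow> 'a" where
  "gradient f x = (THE D. GDERIV f x :> D)"

definition continuously_differentiable :: "('a::real_inner \<Rightarrow> real) \<Rightarrow> bool" where
  "continuously_differentiable f \<longleftrightarrow>
     (\<exists>g. (\<forall>x. GDERIV f x :> g x) \<and> continuous_on UNIV g)"

definition strongly_convex_on :: "'a::real_inner set \<Rightarrow> ('a \<Rightarrow> real) \<Rightarrow> bool" where
  "strongly_convex_on X \<psi> \<longleftrightarrow> convex X \<and>
     (\<exists>m>0. \<forall>x\<in>X. \<forall>y\<in>X. \<forall>u\<in>{0..1}.
        \<psi> (u *\<^sub>R x + (1 - u) *\<^sub>R y)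
          \<le> u * \<psi> x + (1 - u) * \<psi> y - m / 2 * u * (1 - u) * (norm (x - y))\<^sup>2)"

(* A real-valued supremum: in finite dimension and for nonempty X it is finite whenever
   strongly_convex_on X \<psi> holds, since \<psi> then dominates an affine function plus a
   positive multiple of the squared norm. *)
definition convex_conjugate :: "'a::real_inner set \<Rightarrow> ('a \<Rightarrow> real) \<Rightarrow> 'a \<Rightarrow> real" where
  "convex_conjugate X \<psi> z = (SUP x\<in>X. z \<bullet> x - \<psi> x)"

(* The time domain T is an interval; derivatives are taken within T, hence one-sided at an
   endpoint belonging to T.  The witness v is the velocity of x. *)
definition heavy_ball ::
  "('a::real_inner \<Rightarrow> real) \<Rightarrow> real \<Rightarrow> real \<Rightarrow> real set \<Rightarrow> (real \<Rightarrow> 'a) \<Rightarrow> bool" where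
  "heavy_ball f a1 a2 T x \<longleftrightarrow>
     (\<exists>v. \<forall>t\<in>T.
        (x has_vector_derivative v t) (at t within T) \<and>
        (v has_vector_derivative (a1 *\<^sub>R v t + a2 *\<^sub>R gradient f (x t))) (at t within T))"

(* \<alpha>' is the time derivative of \<alpha>. *)
definition momentum_data ::
  "'a::real_inner set \<Rightarrow> ('a \<Rightarrow> real) \<Rightarrow> (real \<Rightarrow> real) \<Rightarrow> real set
     \<Rightarrow> (real \<Rightarrow> real) \<Rightarrow> (real \<Rightarrow> real) \<Rightarrow> bool" where
  "momentum_data X \<psi> h T \<alpha> \<alpha>' \<longleftrightarrow>
     closed X \<and> strongly_convex_on X \<psi> \<and> (\<forall>\<tau>>0. h \<tau> > 0) \<and>
     (\<forall>t\<in>T. \<alpha> t > 0 \<and> (\<alpha> has_real_derivative \<alpha>' t) (at t within T)) \<and>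
     strict_mono_on T \<alpha>"

definition momentum_dynamics ::
  "('a::real_inner \<Rightarrow> real) \<Rightarrow> 'a set \<Rightarrow> ('a \<Rightarrow> real) \<Rightarrow> (real \<Rightarrow> real) \<Rightarrow> real set
     \<Rightarrow> (real \<Rightarrow> real) \<Rightarrow> (real \<Rightarrow> real) \<Rightarrow> (real \<Rightarrow> 'a) \<Rightarrow> (real \<Rightarrow> 'a) \<Rightarrow> bool" where
  "momentum_dynamics f X \<psi> h T \<alpha> \<alpha>' x z \<longleftrightarrow>
     (\<forall>t\<in>T. x t \<in> X \<and>
        (x has_vector_derivative
           (\<alpha>' t / \<alpha> t) *\<^sub>R (gradient (convex_conjugate X \<psi>) (z t) - x t)) (at t within T) \<and>
        (z has_vector_derivative
           - (h (\<alpha> t) * (\<alpha>' t / \<alpha> t)) *\<^sub>R gradient f (x t)) (at t within T))"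

(* The choices that specialise the momentum dynamics to the heavy ball method.  The norm
   on real ^ 'n is the Euclidean one. *)
definition heavy_ball_choice ::
  "real \<Rightarrow> real \<Rightarrow> (real ^ 'n \<Rightarrow> real) \<Rightarrow> (real \<Rightarrow> real) \<Rightarrow> real set
     \<Rightarrow> (real \<Rightarrow> real) \<Rightarrow> (real \<Rightarrow> real) \<Rightarrow> bool" where
  "heavy_ball_choice \<mu> \<eta> \<psi> h T \<alpha> \<alpha>' \<longleftrightarrow>
     momentum_data UNIV \<psi> h T \<alpha> \<alpha>' \<and>
     (\<forall>z. convex_conjugate UNIV \<psi> z = 1 / (2 * \<mu>) * (norm z)\<^sup>2) \<and>
     (\<forall>\<tau>>0. h \<tau> = \<tau> ^ 0) \<and>
     (\<forall>t\<in>T. \<alpha>' t / \<alpha> t = \<eta>)"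

end

theory Submission
  imports Defs
begin

text \<open>
  With \<open>\<nabla>\<psi>\<^sup>*(z) = z / \<mu>\<close>, \<open>h = 1\<close> and \<open>\<alpha>' / \<alpha> = \<eta>\<close> the momentum dynamics are the first-order system
  \<open>x' = \<eta> (z / \<mu> - x)\<close>, \<open>z' = - \<eta> \<nabla>f(x)\<close>. Its first equation determines \<open>z\<close> from \<open>x\<close> and the
  velocity \<open>v = x'\<close>, and conversely: \<open>v = \<eta> (z / \<mu> - x)\<close> and \<open>z = \<mu> (x + v / \<eta>)\<close>.
  Differentiating either relation along a trajectory turns the second equation into
  \<open>v' = - \<eta> v - (\<eta>\<^sup>2 / \<mu>) \<nabla>f(x)\<close> and back, so the system is the heavy ball equation after a linear
  change of the auxiliary variable (\<open>heavy_ball_iff_momentum\<close>).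

  Every pair of negative heavy ball coefficients arises in this way: \<open>\<eta> = - a1\<close> and
  \<open>\<mu> = - a1\<^sup>2 / a2\<close> solve \<open>- \<eta> = a1\<close>, \<open>- \<eta>\<^sup>2 / \<mu> = a2\<close>, and the required data exist because a
  multiple of the squared norm has the prescribed conjugate and \<open>\<alpha> = exp (\<eta> t)\<close> has logarithmic
  derivative \<open>\<eta>\<close> (\<open>heavy_ball_choice_exists\<close>).
\<close>

lemma gradient_eqI:
  assumes "GDERIV f x :> D"
  shows "gradient f x = D"
  unfolding gradient_def
proof (rule the_equality)
  fix D' assume "GDERIV f x :> D'"
  then have "(\<lambda>h. h \<bullet> D') = (\<lambda>h. h \<bullet> D)"
    using assms has_derivative_unique unfolding gderiv_def by blast
  then show "D' = D"
    by (simp only: fun_eq_iff vector_eq_ldot)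
qed (rule assms)

lemma gradient_scaled_norm_squared:
  fixes z :: "'a::real_inner"
  shows "gradient (\<lambda>z::'a. 1 / (2 * \<mu>) * (norm z)\<^sup>2) z = (1 / \<mu>) *\<^sub>R z"
proof (rule gradient_eqI)
  have "((\<lambda>z::'a. 1 / (2 * \<mu>) * (z \<bullet> z)) has_derivative (\<lambda>h. h \<bullet> ((1 / \<mu>) *\<^sub>R z))) (at z)"
    by (cases "\<mu> = 0") (auto intro!: derivative_eq_intros simp: inner_commute)
  then show "GDERIV (\<lambda>z::'a. 1 / (2 * \<mu>) * (norm z)\<^sup>2) z :> (1 / \<mu>) *\<^sub>R z"
    by (simp add: gderiv_def power2_norm_eq_inner)
qed

text \<open>
  Completing the square gives \<open>z \<bullet> x - \<mu> / 2 |x|\<^sup>2 = |z|\<^sup>2 / (2 \<mu>) - \<mu> / 2 |x - z / \<mu>|\<^sup>2\<close>, so the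
  supremum is a maximum, attained at \<open>x = z / \<mu>\<close>.
\<close>
lemma convex_conjugate_scaled_norm_squared:
  fixes z :: "'a::real_inner"
  assumes "\<mu> > 0"
  shows "convex_conjugate UNIV (\<lambda>x::'a. \<mu> / 2 * (norm x)\<^sup>2) z = 1 / (2 * \<mu>) * (norm z)\<^sup>2"
proof -
  have square: "z \<bullet> x - \<mu> / 2 * (norm x)\<^sup>2
      = 1 / (2 * \<mu>) * (norm z)\<^sup>2 - \<mu> / 2 * (norm (x - (1 / \<mu>) *\<^sub>R z))\<^sup>2" for x
  proof -
    have expand: "(norm (x - (1 / \<mu>) *\<^sub>R z))\<^sup>2
        = (norm x)\<^sup>2 - 2 / \<mu> * (z \<bullet> x) + (1 / \<mu>)\<^sup>2 * (norm z)\<^sup>2"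
      unfolding power2_norm_eq_inner inner_diff_left inner_diff_right inner_scaleR_left
        inner_scaleR_right inner_commute[of x z]
      by (simp add: algebra_simps power2_eq_square)
    show ?thesis
      unfolding expand using assms by (simp add: field_simps power2_eq_square)
  qed
  show ?thesis
    unfolding convex_conjugate_def square
  proof (rule cSup_eq_maximum)
    show "1 / (2 * \<mu>) * (norm z)\<^sup>2 \<in>
        range (\<lambda>x. 1 / (2 * \<mu>) * (norm z)\<^sup>2 - \<mu> / 2 * (norm (x - (1 / \<mu>) *\<^sub>R z))\<^sup>2)"
      by (rule image_eqI[of _ _ "(1 / \<mu>) *\<^sub>R z"]) simp_all
  qed (use assms in auto)
qed

text \<open>The defining inequality holds with equality for \<open>m = \<mu>\<close>.\<close>
lemma strongly_convex_on_scaled_norm_squared: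
  assumes "\<mu> > 0"
  shows "strongly_convex_on UNIV (\<lambda>x::'a::real_inner. \<mu> / 2 * (norm x)\<^sup>2)"
proof -
  have combination: "(norm (u *\<^sub>R x + (1 - u) *\<^sub>R y))\<^sup>2
      = u * (norm x)\<^sup>2 + (1 - u) * (norm y)\<^sup>2 - u * (1 - u) * (norm (x - y))\<^sup>2"
    for u and x y :: 'a
    unfolding power2_norm_eq_inner inner_add_left inner_add_right inner_diff_left inner_diff_right
      inner_scaleR_left inner_scaleR_right inner_commute[of y x]
    by (simp add: algebra_simps)
  have "c * (norm (u *\<^sub>R x + (1 - u) *\<^sub>R y))\<^sup>2
      = u * (c * (norm x)\<^sup>2) + (1 - u) * (c * (norm y)\<^sup>2)
        - c * u * (1 - u) * (norm (x - y))\<^sup>2" for c u and x y :: 'a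
    unfolding combination by (simp add: algebra_simps)
  then show ?thesis
    unfolding strongly_convex_on_def using assms
    by (intro conjI exI[of _ \<mu>] ballI convex_UNIV) (simp_all only: order_refl)
qed

lemma heavy_ball_choice_exists:
  fixes T :: "real set"
  assumes "\<mu> > 0" and "\<eta> > 0"
  shows "heavy_ball_choice \<mu> \<eta> (\<lambda>x::real ^ 'n. \<mu> / 2 * (norm x)\<^sup>2) (\<lambda>_. 1) T
           (\<lambda>t. exp (\<eta> * t)) (\<lambda>t. \<eta> * exp (\<eta> * t))"
proof -
  have "((\<lambda>t. exp (\<eta> * t)) has_real_derivative \<eta> * exp (\<eta> * t)) (at t within T)" for t
    by (auto intro!: derivative_eq_intros)
  moreover have "strict_mono_on T (\<lambda>t. exp (\<eta> * t))"
    using assms by (auto simp: strict_mono_on_def)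
  ultimately show ?thesis
    unfolding heavy_ball_choice_def momentum_data_def
    using strongly_convex_on_scaled_norm_squared[OF \<open>\<mu> > 0\<close>, where 'a = "real ^ 'n"]
      convex_conjugate_scaled_norm_squared[OF \<open>\<mu> > 0\<close>, where 'a = "real ^ 'n"]
    by (simp del: times_divide_eq_left)
qed

text \<open>
  The first-order system behind the momentum dynamics. Since \<open>\<alpha>\<close> enters only through
  \<open>\<alpha>' / \<alpha>\<close> once \<open>h\<close> is constant on the positive reals, a constant ratio leaves an autonomous system.
\<close>
lemma momentum_dynamics_heavy_ball_choice:
  assumes "heavy_ball_choice \<mu> \<eta> \<psi> h T \<alpha> \<alpha>'"
  shows "momentum_dynamics f UNIV \<psi> h T \<alpha> \<alpha>' x z \<longleftrightarrow>
     (\<forall>t\<in>T. (x has_vector_derivative \<eta> *\<^sub>R ((1 / \<mu>) *\<^sub>R z t - x t)) (at t within T) \<and>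
            (z has_vector_derivative - \<eta> *\<^sub>R gradient f (x t)) (at t within T))"
proof -
  have "convex_conjugate UNIV \<psi> = (\<lambda>z. 1 / (2 * \<mu>) * (norm z)\<^sup>2)"
    using assms by (auto simp: heavy_ball_choice_def)
  then have "gradient (convex_conjugate UNIV \<psi>) w = (1 / \<mu>) *\<^sub>R w" for w
    by (simp only: gradient_scaled_norm_squared)
  moreover have "h (\<alpha> t) = 1" and "\<alpha>' t / \<alpha> t = \<eta>" if "t \<in> T" for t
    using assms that by (auto simp: heavy_ball_choice_def momentum_data_def)
  ultimately show ?thesis
    unfolding momentum_dynamics_def by simp
qed

lemma heavy_ball_iff_momentum:
  fixes x :: "real \<Rightarrow> real ^ 'n"
  assumes choice: "heavy_ball_choice \<mu> \<eta> \<psi> h T \<alpha> \<alpha>'" and "\<mu> > 0" and "\<eta> > 0"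
  shows "heavy_ball f (- \<eta>) (- (\<eta>\<^sup>2 / \<mu>)) T x \<longleftrightarrow>
         (\<exists>z. momentum_dynamics f UNIV \<psi> h T \<alpha> \<alpha>' x z)"
proof
  assume "heavy_ball f (- \<eta>) (- (\<eta>\<^sup>2 / \<mu>)) T x"
  then obtain v where x: "\<And>t. t \<in> T \<Longrightarrow> (x has_vector_derivative v t) (at t within T)"
    and v: "\<And>t. t \<in> T \<Longrightarrow> (v has_vector_derivative
        - \<eta> *\<^sub>R v t + - (\<eta>\<^sup>2 / \<mu>) *\<^sub>R gradient f (x t)) (at t within T)"
    unfolding heavy_ball_def by blast
  define z where "z = (\<lambda>t. \<mu> *\<^sub>R (x t + (1 / \<eta>) *\<^sub>R v t))"
  have "v t = \<eta> *\<^sub>R ((1 / \<mu>) *\<^sub>R z t - x t)" for t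
    using assms by (simp add: z_def)
  moreover have "(z has_vector_derivative - \<eta> *\<^sub>R gradient f (x t)) (at t within T)"
    if "t \<in> T" for t
  proof -
    have "(z has_vector_derivative
        \<mu> *\<^sub>R (v t + (1 / \<eta>) *\<^sub>R (- \<eta> *\<^sub>R v t + - (\<eta>\<^sup>2 / \<mu>) *\<^sub>R gradient f (x t)))) (at t within T)"
      unfolding z_def using x[OF that] v[OF that]
      by (intro bounded_linear.has_vector_derivative[OF bounded_linear_scaleR_right]
          has_vector_derivative_add)
    moreover have "\<mu> *\<^sub>R (v t + (1 / \<eta>) *\<^sub>R (- \<eta> *\<^sub>R v t + - (\<eta>\<^sup>2 / \<mu>) *\<^sub>R gradient f (x t)))
        = - \<eta> *\<^sub>R gradient f (x t)"
      using assms by (simp add: algebra_simps power2_eq_square)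
    ultimately show ?thesis by simp
  qed
  ultimately show "\<exists>z. momentum_dynamics f UNIV \<psi> h T \<alpha> \<alpha>' x z"
    unfolding momentum_dynamics_heavy_ball_choice[OF choice] using x by metis
next
  assume "\<exists>z. momentum_dynamics f UNIV \<psi> h T \<alpha> \<alpha>' x z"
  then obtain z where
    x: "\<And>t. t \<in> T \<Longrightarrow>
        (x has_vector_derivative \<eta> *\<^sub>R ((1 / \<mu>) *\<^sub>R z t - x t)) (at t within T)"
    and z: "\<And>t. t \<in> T \<Longrightarrow> (z has_vector_derivative - \<eta> *\<^sub>R gradient f (x t)) (at t within T)"
    unfolding momentum_dynamics_heavy_ball_choice[OF choice] by blast
  define v where "v = (\<lambda>t. \<eta> *\<^sub>R ((1 / \<mu>) *\<^sub>R z t - x t))"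
  have "(v has_vector_derivative - \<eta> *\<^sub>R v t + - (\<eta>\<^sup>2 / \<mu>) *\<^sub>R gradient f (x t)) (at t within T)"
    if "t \<in> T" for t
  proof -
    have "(v has_vector_derivative
        \<eta> *\<^sub>R ((1 / \<mu>) *\<^sub>R (- \<eta> *\<^sub>R gradient f (x t)) - v t)) (at t within T)"
      unfolding v_def using x[OF that] z[OF that]
      by (intro bounded_linear.has_vector_derivative[OF bounded_linear_scaleR_right]
          has_vector_derivative_diff)
    moreover have "\<eta> *\<^sub>R ((1 / \<mu>) *\<^sub>R (- \<eta> *\<^sub>R gradient f (x t)) - v t)
        = - \<eta> *\<^sub>R v t + - (\<eta>\<^sup>2 / \<mu>) *\<^sub>R gradient f (x t)"
      by (simp add: algebra_simps power2_eq_square)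
    ultimately show ?thesis by simp
  qed
  moreover have "(x has_vector_derivative v t) (at t within T)" if "t \<in> T" for t
    using x[OF that] by (simp add: v_def)
  ultimately show "heavy_ball f (- \<eta>) (- (\<eta>\<^sup>2 / \<mu>)) T x"
    unfolding heavy_ball_def by blast
qed

theorem proposition2p2:
  fixes f :: "real ^ 'n \<Rightarrow> real" and T :: "real set"
  assumes "continuously_differentiable f"
    and "is_interval T" and "interior T \<noteq> {}"
  shows
    "(\<forall>\<mu>>0. \<forall>\<eta>>0. \<forall>\<psi> h \<alpha> \<alpha>'. heavy_ball_choice \<mu> \<eta> \<psi> h T \<alpha> \<alpha>' \<longrightarrow>
        (\<forall>x. heavy_ball f (- \<eta>) (- (\<eta>\<^sup>2 / \<mu>)) T x \<longleftrightarrow>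
             (\<exists>z. momentum_dynamics f UNIV \<psi> h T \<alpha> \<alpha>' x z)))
     \<and>
     (\<forall>a1<0. \<forall>a2<0. \<exists>\<mu>>0. \<exists>\<eta>>0. \<exists>\<psi> h \<alpha> \<alpha>'. heavy_ball_choice \<mu> \<eta> \<psi> h T \<alpha> \<alpha>' \<and>
        (\<forall>x. heavy_ball f a1 a2 T x \<longleftrightarrow>
             (\<exists>z. momentum_dynamics f UNIV \<psi> h T \<alpha> \<alpha>' x z)))"
proof (intro conjI allI impI)
  fix \<mu> \<eta> :: real and \<psi> :: "real ^ 'n \<Rightarrow> real" and h \<alpha> \<alpha>' x
  assume "\<mu> > 0" "\<eta> > 0" and "heavy_ball_choice \<mu> \<eta> \<psi> h T \<alpha> \<alpha>'"
  then show "heavy_ball f (- \<eta>) (- (\<eta>\<^sup>2 / \<mu>)) T x \<longleftrightarrow>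
      (\<exists>z. momentum_dynamics f UNIV \<psi> h T \<alpha> \<alpha>' x z)"
    by (intro heavy_ball_iff_momentum)
next
  fix a1 a2 :: real
  assume a: "a1 < 0" "a2 < 0"
  define \<eta> where "\<eta> = - a1"
  define \<mu> where "\<mu> = - (a1\<^sup>2 / a2)"
  have pos: "\<mu> > 0" "\<eta> > 0"
    using a by (auto simp: \<mu>_def \<eta>_def divide_pos_neg)
  have coeffs: "- \<eta> = a1" "- (\<eta>\<^sup>2 / \<mu>) = a2"
    using a by (auto simp: \<mu>_def \<eta>_def)
  note choice = heavy_ball_choice_exists[OF pos, where T = T and 'n = 'n]
  show "\<exists>\<mu>>0. \<exists>\<eta>>0. \<exists>\<psi> h \<alpha> \<alpha>'. heavy_ball_choice \<mu> \<eta> \<psi> h T \<alpha> \<alpha>' \<and>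
      (\<forall>x. heavy_ball f a1 a2 T x \<longleftrightarrow> (\<exists>z. momentum_dynamics f UNIV \<psi> h T \<alpha> \<alpha>' x z))"
    by (intro exI conjI allI)
      (rule pos choice heavy_ball_iff_momentum[OF choice pos, of f, unfolded coeffs])+
qed

end
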